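(* Let $d\ge1$. Assume that $F\in C[-1,1]$ and $I_F(\sigma)\ge0$. Then $\sigma$ is a minimizer of $I_F(\mu)$ over $\mu\in\mathcal M$ if and only if $F\in\Phi_d$.
   Context: $\mathbb S^d\subset\mathbb R^{d+1}$ is the unit sphere, $\sigma$ is the normalized surface measure ($\sigma(\mathbb S^d)=1$), $\mathcal M$ is the set of Borel probability measures on $\mathbb S^d$, and $I_F(\mu)=\int_{\mathbb S^d}\int_{\mathbb S^d}F(x\cdot y)\,d\mu(x)\,d\mu(y)$. $\Phi_d$ is the class of functions $F\in C[-1,1]$ that are positive definite on $\mathbb S^d$: for every finite set $\{z_1,\dots,z_N\}\subset\mathbb S^d$ and all $c_i\in\mathbb R$, $\sum_{i,j}F(z_i\cdot z_j)c_ic_j\ge0$. *)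

theory Defs
  imports "HOL-Probability.Probability"
begin

abbreviation unit_sphere :: "(real ^ 'n) set"
  where "unit_sphere \<equiv> sphere 0 1"

abbreviation sphere_borel :: "(real ^ 'n) measure"
  where "sphere_borel \<equiv> restrict_space borel unit_sphere"

text \<open>
  Surface measure given by polar coordinates: the surface area of \<open>E\<close> is the dimension
  \<open>CARD('n)\<close> of the ambient space times the Lebesgue measure of the cone over \<open>E\<close>; see
  \<open>emeasure_surface_measure\<close> below.
\<close>
definition surface_measure :: "(real ^ 'n) measure"
  where "surface_measure =
    scale_measure (of_nat CARD('n))
      (distr (restrict_space lborel (ball 0 1 - {0})) sphere_borel (\<lambda>x. x /\<^sub>R norm x))"

definition sigma_sphere :: "(real ^ 'n) measure"
  where "sigma_sphere =
    scale_measure (inverse (emeasure surface_measure (unit_sphere :: (real ^ 'n) set)))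
      surface_measure"

definition prob_measures :: "(real ^ 'n) measure set"
  where "prob_measures = {\<mu>. prob_space \<mu> \<and> sets \<mu> = sets sphere_borel}"

definition energy :: "(real \<Rightarrow> real) \<Rightarrow> (real ^ 'n) measure \<Rightarrow> real"
  where "energy F \<mu> = (LINT y|\<mu>. LINT x|\<mu>. F (x \<bullet> y))"

text \<open>
  The class depends on the dimension of the sphere only, which is passed as the index type
  \<open>'n\<close> of the ambient space. Values of \<open>F\<close> outside \<open>{-1..1}\<close> are irrelevant.
\<close>
definition Phi :: "'n::finite itself \<Rightarrow> (real \<Rightarrow> real) set"
  where "Phi _ = {F. continuous_on {-1..1} F \<and>
    (\<forall>Z c. finite Z \<and> Z \<subseteq> (unit_sphere :: (real ^ 'n) set) \<longrightarrow>
      (\<Sum>x\<in>Z. \<Sum>y\<in>Z. F (x \<bullet> y) * c x * c y) \<ge> 0)}"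

lemma normalize_measurable:
  "(\<lambda>x. x /\<^sub>R norm x) \<in> measurable (restrict_space lborel (ball 0 1 - {0})) (sphere_borel :: (real ^ 'n) measure)"
proof (rule measurable_restrict_space2)
  show "(\<lambda>x. x /\<^sub>R norm x) \<in> space (restrict_space lborel (ball 0 1 - {0 :: real ^ 'n})) \<rightarrow> unit_sphere"
    by (auto simp: space_restrict_space)
  show "(\<lambda>x. x /\<^sub>R norm x) \<in> borel_measurable (restrict_space lborel (ball 0 1 - {0 :: real ^ 'n}))"
    by (rule measurable_restrict_space1) simp
qed

lemma emeasure_surface_measure:
  fixes E :: "(real ^ 'n) set"
  assumes "E \<in> sets sphere_borel"
  shows "emeasure surface_measure E =
    of_nat CARD('n) * emeasure lborel {r *\<^sub>R x |r x. 0 < r \<and> r < 1 \<and> x \<in> E}"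
proof -
  have E: "E \<subseteq> unit_sphere"
    using sets.sets_into_space[OF assms] by (simp add: space_restrict_space)
  have "(\<lambda>x. x /\<^sub>R norm x) -` E \<inter> (ball 0 1 - {0}) = {r *\<^sub>R x |r x. 0 < r \<and> r < 1 \<and> x \<in> E}"
    (is "?L = ?R")
  proof (intro equalityI subsetI)
    fix x assume "x \<in> ?L"
    then have "x = norm x *\<^sub>R (x /\<^sub>R norm x)" "0 < norm x" "norm x < 1" "x /\<^sub>R norm x \<in> E"
      by auto
    then show "x \<in> ?R" by blast
  next
    fix y assume "y \<in> ?R"
    then obtain r x where "y = r *\<^sub>R x" "0 < r" "r < 1" "x \<in> E" by blast
    moreover from \<open>x \<in> E\<close> E have "norm x = 1" by auto
    ultimately show "y \<in> ?L" by auto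
  qed
  moreover from this have "?R \<subseteq> ball 0 1 - {0}" by blast
  ultimately show ?thesis
    using assms
    by (simp add: surface_measure_def emeasure_distr[OF normalize_measurable]
        emeasure_restrict_space space_restrict_space)
qed

lemma sigma_sphere_in_prob_measures: "(sigma_sphere :: (real ^ 'n) measure) \<in> prob_measures"
proof -
  let ?U = "unit_sphere :: (real ^ 'n) set"
  have ball: "{r *\<^sub>R x |r x. 0 < r \<and> r < 1 \<and> x \<in> ?U} = ball 0 1 - {0}" (is "?L = ?R")
  proof (intro equalityI subsetI)
    fix x assume "x \<in> ?R"
    then have "x = norm x *\<^sub>R (x /\<^sub>R norm x)" "0 < norm x" "norm x < 1" "x /\<^sub>R norm x \<in> ?U"
      by auto
    then show "x \<in> ?L" by blast
  qed auto
  have "emeasure lborel (ball 0 1 - {0 :: real ^ 'n}) = emeasure lborel (ball (0 :: real ^ 'n) 1)"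
    by (subst emeasure_Diff) auto
  then have "emeasure surface_measure ?U = of_nat CARD('n) * emeasure lborel (ball (0 :: real ^ 'n) 1)"
    using emeasure_surface_measure[of ?U] unfolding ball by (simp add: sets_restrict_space_iff)
  moreover have "emeasure lborel (ball (0 :: real ^ 'n) 1) \<noteq> 0"
    by (simp add: emeasure_ball content_ball_pos less_imp_neq[symmetric] unit_ball_vol_pos)
  moreover have "emeasure lborel (ball (0 :: real ^ 'n) 1) \<noteq> \<infinity>"
    using emeasure_lborel_ball_finite[of 0 1] by (metis infinity_ennreal_def less_irrefl)
  ultimately have "emeasure surface_measure ?U \<noteq> 0" "emeasure surface_measure ?U \<noteq> \<infinity>"
    by (auto simp: ennreal_mult_eq_top_iff)
  then have "emeasure sigma_sphere ?U = 1"
    by (simp add: sigma_sphere_def ennreal_divide_self less_top mult.commute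
        flip: divide_ennreal_def)
  moreover have "sets (sigma_sphere :: (real ^ 'n) measure) = sets sphere_borel"
    by (simp add: sigma_sphere_def surface_measure_def)
  moreover from this have "space (sigma_sphere :: (real ^ 'n) measure) = ?U"
    by (metis sets_eq_imp_space_eq space_restrict_space space_borel Int_UNIV_right)
  ultimately show ?thesis
    by (auto simp: prob_measures_def intro: prob_spaceI)
qed

end

theory Submission
  imports Defs
begin

text \<open>
  Rotation invariance makes the potential of \<open>\<sigma>\<close> constant on the sphere, so for every
  \<open>\<mu>\<close> the mutual energy of \<open>\<mu>\<close> and \<open>\<sigma>\<close> is \<open>I_F(\<sigma>)\<close> and
  \<open>I_F(\<mu> - \<sigma>) = I_F(\<mu>) - I_F(\<sigma>)\<close>. If \<open>F\<close> is positive definite, discretising the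
  measures shows that the left-hand side is nonnegative. Conversely, if \<open>\<sigma>\<close> is a minimizer,
  perturbing it by a small multiple of a bounded density \<open>h\<close> of mean zero gives
  \<open>I_F(h \<sigma>) \<ge> 0\<close>; since \<open>I_F(\<sigma>) \<ge> 0\<close> and the cross terms with constants vanish,
  this extends to every bounded density. Densities concentrated on small caps around the points
  \<open>z\<^sub>i\<close> approximate the quadratic form of \<open>F\<close> at these points.
\<close>

subsection \<open>Rotation invariance\<close>

lemma nn_integral_lborel_shift:
  fixes f :: "'a::euclidean_space \<Rightarrow> ennreal"
  assumes [measurable]: "f \<in> borel_measurable borel"
  shows "(\<integral>\<^sup>+x. f (x + a) \<partial>lborel) = (\<integral>\<^sup>+x. f x \<partial>lborel)"
proof -
  have "(\<integral>\<^sup>+x. f x \<partial>lborel) = (\<integral>\<^sup>+x. f x \<partial>distr lborel borel ((+) a))"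
    by (simp add: lborel_distr_plus)
  also have "\<dots> = (\<integral>\<^sup>+x. f (x + a) \<partial>lborel)"
    by (subst nn_integral_distr) (auto simp: add.commute)
  finally show ?thesis ..
qed

text \<open>
  Integrating the indicator of \<open>(x, z)\<close> with \<open>x \<in> ball 0 1\<close> and
  \<open>T z + x \<in> A\<close> in both orders gives the measures of \<open>T -` A\<close> and of \<open>A\<close>, each times
  that of the ball, because the ball is invariant under \<open>T\<close> and \<open>uminus\<close>.
\<close>
lemma lborel_distr_orthogonal:
  fixes T :: "'a::euclidean_space \<Rightarrow> 'a"
  assumes T: "orthogonal_transformation T"
  shows "distr lborel borel T = lborel"
proof -
  have lin: "linear T" and inv: "T (inv T x) = x" for x
    using T by (auto simp: orthogonal_transformation_linear orthogonal_transformation_surj surj_f_inv_f)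
  have [measurable]: "T \<in> borel_measurable borel"
    using lin by (intro borel_measurable_continuous_onI linear_continuous_on) (simp add: linear_linear)
  \<comment> \<open>For fixed \<open>x\<close>, the condition \<open>x - T z \<in> ball 0 1\<close>
    on \<open>z\<close> thus describes a unit ball centred at \<open>inv T x\<close>, whose measure
    does not depend on \<open>x\<close>.\<close>
  have isometry: "norm (x - T z) = dist (inv T x) z" for x z
    using orthogonal_transformation_norm[OF T, of "inv T x - z"]
    by (simp add: linear_diff[OF lin] inv dist_norm)
  let ?B = "ball (0::'a) 1"
  \<comment> \<open>The measure of the ball is cancelled at the end, and in \<open>ennreal\<close>
    this requires a factor that is neither 0 nor infinite.\<close>
  have B_finite: "emeasure lborel ?B \<noteq> \<infinity>"
    using emeasure_lborel_ball_finite[of 0 1] by (metis infinity_ennreal_def less_irrefl)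
  have B_pos: "emeasure lborel ?B \<noteq> 0"
    by (simp add: emeasure_ball content_ball_pos less_imp_neq[symmetric] unit_ball_vol_pos)
  have eq: "emeasure lborel ?B * emeasure lborel (T -` A) = emeasure lborel ?B * emeasure lborel A"
    if [measurable]: "A \<in> sets borel" for A
  proof -
    define a b :: "'a \<Rightarrow> ennreal" where "a = indicator A" and "b = indicator ?B"
    have [measurable]: "a \<in> borel_measurable borel" "b \<in> borel_measurable borel"
      by (auto simp: a_def b_def intro!: borel_measurable_indicator)
    have "T -` A \<in> sets borel"
      using measurable_sets[of T borel borel A] by simp
    then have "emeasure lborel (T -` A) = (\<integral>\<^sup>+z. indicator (T -` A) z \<partial>lborel)"
      by simp
    also have "\<dots> = (\<integral>\<^sup>+z. a (T z) \<partial>lborel)"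
      by (simp add: indicator_def a_def)
    finally have "emeasure lborel (T -` A) = (\<integral>\<^sup>+z. a (T z) \<partial>lborel)" .
    moreover have "emeasure lborel ?B = (\<integral>\<^sup>+x. b x \<partial>lborel)"
      by (simp add: b_def)
    ultimately have "emeasure lborel ?B * emeasure lborel (T -` A)
      = (\<integral>\<^sup>+x. b x * (\<integral>\<^sup>+z. a (T z) \<partial>lborel) \<partial>lborel)"
      by (simp add: nn_integral_multc)
    \<comment> \<open>Since \<open>T z + x = T (z + inv T x)\<close>, adding \<open>x\<close> is a
      translation of the variable \<open>z\<close>.\<close>
    also have "\<dots> = (\<integral>\<^sup>+x. b x * (\<integral>\<^sup>+z. a (T z + x) \<partial>lborel) \<partial>lborel)"
    proof (rule nn_integral_cong)
      fix x
      have "(\<integral>\<^sup>+z. a (T z + x) \<partial>lborel) = (\<integral>\<^sup>+z. a (T (z + inv T x)) \<partial>lborel)"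
        by (simp add: linear_add[OF lin] inv)
      also have "\<dots> = (\<integral>\<^sup>+z. a (T z) \<partial>lborel)"
        by (rule nn_integral_lborel_shift[of "\<lambda>z. a (T z)"]) measurable
      finally show "b x * (\<integral>\<^sup>+z. a (T z) \<partial>lborel) = b x * (\<integral>\<^sup>+z. a (T z + x) \<partial>lborel)"
        by simp
    qed
    also have "\<dots> = (\<integral>\<^sup>+x. \<integral>\<^sup>+z. b x * a (T z + x) \<partial>lborel \<partial>lborel)"
      by (simp add: nn_integral_cmult)
    also have "\<dots> = (\<integral>\<^sup>+z. \<integral>\<^sup>+x. b x * a (T z + x) \<partial>lborel \<partial>lborel)"
      by (rule lborel_pair.Fubini') measurable
    \<comment> \<open>Translating \<open>x\<close> by \<open>T z\<close> moves the dependence on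
      \<open>z\<close> from \<open>a\<close> to \<open>b\<close>, so that the integral over
      \<open>z\<close> sees only the ball.\<close>
    also have "\<dots> = (\<integral>\<^sup>+z. \<integral>\<^sup>+x. b (x - T z) * a x \<partial>lborel \<partial>lborel)"
    proof (rule nn_integral_cong)
      fix z
      show "(\<integral>\<^sup>+x. b x * a (T z + x) \<partial>lborel) = (\<integral>\<^sup>+x. b (x - T z) * a x \<partial>lborel)"
        using nn_integral_lborel_shift[of "\<lambda>x. b (x - T z) * a x" "T z"]
        by (simp add: add.commute)
    qed
    also have "\<dots> = (\<integral>\<^sup>+x. \<integral>\<^sup>+z. b (x - T z) * a x \<partial>lborel \<partial>lborel)"
      by (rule lborel_pair.Fubini') measurable
    also have "\<dots> = (\<integral>\<^sup>+x. emeasure lborel ?B * a x \<partial>lborel)"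
    proof (rule nn_integral_cong)
      fix x
      have "b (x - T z) = indicator (ball (inv T x) 1) z" for z
        by (simp add: indicator_def isometry b_def)
      then have "(\<integral>\<^sup>+z. b (x - T z) \<partial>lborel) = emeasure lborel ?B"
        by (simp add: emeasure_ball)
      then show "(\<integral>\<^sup>+z. b (x - T z) * a x \<partial>lborel) = emeasure lborel ?B * a x"
        by (subst nn_integral_multc) auto
    qed
    also have "\<dots> = emeasure lborel ?B * emeasure lborel A"
      by (simp add: nn_integral_cmult a_def)
    finally show ?thesis .
  qed
  show ?thesis
  proof (rule measure_eqI)
    fix A assume "A \<in> sets (distr lborel borel T)"
    then have [measurable]: "A \<in> sets borel" by simp
    show "emeasure (distr lborel borel T) A = emeasure lborel A"
      using eq[of A] B_finite B_pos by (simp add: emeasure_distr ennreal_mult_cancel_left)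
  qed simp
qed

section \<open>Caps, orthogonal invariance and the potential of \<open>sigma_sphere\<close>\<close>

lemma borel_measurable_prob_measures:
  assumes "\<mu> \<in> prob_measures" "f \<in> borel_measurable borel"
  shows "f \<in> borel_measurable \<mu>"
  using assms by (simp add: prob_measures_def measurable_restrict_space1 cong: measurable_cong_sets)

lemma space_prob_measures: "\<mu> \<in> prob_measures \<Longrightarrow> space \<mu> = unit_sphere"
  unfolding prob_measures_def
  by (metis (mono_tags, lifting) mem_Collect_eq sets_eq_imp_space_eq space_restrict_space space_borel Int_UNIV_right)

text \<open>Only the non-vanishing of the normalizing constant matters for transferring positivity
  and invariance from \<open>surface_measure\<close>, so its value is hidden. A zero constant would
  contradict total mass 1.\<close>

lemma sigma_sphere_eq_scale:
  obtains c where "c \<noteq> 0" "(sigma_sphere :: (real ^ 'n) measure) = scale_measure c surface_measure"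
proof
  let ?c = "inverse (emeasure surface_measure (unit_sphere :: (real ^ 'n) set))"
  show eq: "(sigma_sphere :: (real ^ 'n) measure) = scale_measure ?c surface_measure"
    by (rule sigma_sphere_def)
  show "?c \<noteq> 0"
  proof
    assume "?c = 0"
    then have "emeasure (sigma_sphere :: (real ^ 'n) measure) (space sigma_sphere) = 0"
      unfolding eq by (metis emeasure_scale_measure mult_zero_left)
    moreover have "prob_space (sigma_sphere :: (real ^ 'n) measure)"
      using sigma_sphere_in_prob_measures by (auto simp: prob_measures_def)
    ultimately show False
      using prob_space.emeasure_space_1 by fastforce
  qed
qed

text \<open>Describing the cone by the radial projection makes openness and the effect of linear
  maps easy to read off. As \<open>E\<close> consists of unit vectors, the parameter
  \<open>r\<close> is the norm of the point.\<close>

lemma cone_eq: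
  fixes E :: "(real ^ 'n) set"
  assumes "E \<subseteq> unit_sphere"
  shows "{r *\<^sub>R x |r x. 0 < r \<and> r < 1 \<and> x \<in> E} = {x \<in> ball 0 1 - {0}. x /\<^sub>R norm x \<in> E}"
proof (intro equalityI subsetI)
  fix x assume "x \<in> {x \<in> ball 0 1 - {0}. x /\<^sub>R norm x \<in> E}"
  then have "x = norm x *\<^sub>R (x /\<^sub>R norm x)" "0 < norm x" "norm x < 1" "x /\<^sub>R norm x \<in> E"
    by auto
  then show "x \<in> {r *\<^sub>R x |r x. 0 < r \<and> r < 1 \<and> x \<in> E}" by blast
next
  fix y assume "y \<in> {r *\<^sub>R x |r x. 0 < r \<and> r < 1 \<and> x \<in> E}"
  then obtain r x where "y = r *\<^sub>R x" "0 < r" "r < 1" "x \<in> E" by blast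
  moreover from \<open>x \<in> E\<close> assms have "norm x = 1" by auto
  ultimately show "y \<in> {x \<in> ball 0 1 - {0}. x /\<^sub>R norm x \<in> E}" by auto
qed

text \<open>The radial projection is continuous off 0, so the cone over the cap is open; it contains
  half of \<open>z\<close>. A nonempty open set is not Lebesgue null. Positivity allows the
  indicator of a cap to be normalized to a density later.\<close>

lemma sigma_sphere_cap_pos:
  fixes z :: "real ^ 'n"
  assumes "norm z = 1" "\<delta> > 0"
  shows "measure sigma_sphere (ball z \<delta> \<inter> unit_sphere) > 0"
proof -
  let ?E = "ball z \<delta> \<inter> unit_sphere"
  let ?C = "{x \<in> ball 0 1 - {0}. x /\<^sub>R norm x \<in> ?E}"
  have E: "?E \<in> sets sphere_borel"
    by (simp add: sets_restrict_space_iff)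
  have "open ((ball 0 1 - {0}) \<inter> (\<lambda>x. x /\<^sub>R norm x) -` ball z \<delta>)"
    by (intro continuous_open_preimage continuous_intros) auto
  also have "(ball 0 1 - {0}) \<inter> (\<lambda>x. x /\<^sub>R norm x) -` ball z \<delta> = ?C"
    by auto
  finally have "open ?C" .
  moreover have "(1/2) *\<^sub>R z \<in> ?C"
    using assms by (auto simp: norm_mult)
  ultimately have "\<not> negligible ?C"
    using open_not_negligible by blast
  then have "emeasure lborel ?C \<noteq> 0"
    using \<open>open ?C\<close> by (auto simp: negligible_iff_null_sets null_sets_def)
  then have "emeasure surface_measure ?E \<noteq> 0"
    by (simp only: emeasure_surface_measure[OF E] cone_eq[of ?E, OF Int_lower2]) simp
  moreover obtain c where "c \<noteq> 0" and c: "(sigma_sphere :: (real ^ 'n) measure) = scale_measure c surface_measure"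
    by (rule sigma_sphere_eq_scale)
  ultimately have pos: "emeasure sigma_sphere ?E \<noteq> 0"
    unfolding c by simp
  interpret prob_space "sigma_sphere :: (real ^ 'n) measure"
    using sigma_sphere_in_prob_measures by (auto simp: prob_measures_def)
  show ?thesis
    using pos by (simp add: emeasure_eq_measure zero_less_measure_iff)
qed

text \<open>An orthogonal map commutes with the radial projection and preserves the punctured ball,
  so the cone over the preimage of \<open>E\<close> is the preimage of the cone over
  \<open>E\<close>. The claim then reduces to the invariance of \<open>lborel\<close>.\<close>

lemma sigma_sphere_distr_orthogonal:
  fixes T :: "real ^ 'n \<Rightarrow> real ^ 'n"
  assumes T: "orthogonal_transformation T"
  shows "T \<in> measurable sphere_borel sphere_borel"
    and "distr sigma_sphere sphere_borel T = sigma_sphere"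
proof -
  have lin: "linear T" and norm_T: "norm (T x) = norm x" for x
    using T by (auto simp: orthogonal_transformation_linear orthogonal_transformation_norm)
  have [measurable]: "T \<in> borel_measurable borel"
    using lin by (intro borel_measurable_continuous_onI linear_continuous_on) (simp add: linear_linear)
  show T_meas: "T \<in> measurable sphere_borel sphere_borel"
    by (intro measurable_restrict_space2 measurable_restrict_space1) (auto simp: space_restrict_space norm_T)
  have sets_sigma: "sets (sigma_sphere :: (real ^ 'n) measure) = sets sphere_borel"
    and space_sigma: "space (sigma_sphere :: (real ^ 'n) measure) = unit_sphere"
    using sigma_sphere_in_prob_measures[where 'n='n] space_prob_measures[of "sigma_sphere :: (real ^ 'n) measure"]
    by (auto simp: prob_measures_def)
  obtain c where c: "(sigma_sphere :: (real ^ 'n) measure) = scale_measure c surface_measure"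
    by (rule sigma_sphere_eq_scale)
  show "distr sigma_sphere sphere_borel T = sigma_sphere"
  proof (rule measure_eqI)
    fix E assume "E \<in> sets (distr (sigma_sphere :: (real ^ 'n) measure) sphere_borel T)"
    then have E: "E \<in> sets sphere_borel" by simp
    then have E_sub: "E \<subseteq> unit_sphere"
      using sets.sets_into_space by (fastforce simp: space_restrict_space)
    have TE: "T -` E \<inter> unit_sphere \<in> sets sphere_borel"
      using measurable_sets[OF T_meas E] by (simp add: space_restrict_space)
    let ?C = "{x \<in> ball 0 1 - {0}. x /\<^sub>R norm x \<in> E}"
    have "(\<lambda>x. x /\<^sub>R norm x) -` E \<inter> space (restrict_space lborel (ball 0 1 - {0}))
        \<in> sets (restrict_space lborel (ball 0 1 - {0 :: real ^ 'n}))"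
      using normalize_measurable E by (rule measurable_sets)
    also have "(\<lambda>x. x /\<^sub>R norm x) -` E \<inter> space (restrict_space lborel (ball 0 1 - {0})) = ?C"
      by (auto simp: space_restrict_space)
    finally have C: "?C \<in> sets borel"
      by (subst (asm) sets_restrict_space_iff) auto
    have "{x \<in> ball 0 1 - {0}. x /\<^sub>R norm x \<in> T -` E \<inter> unit_sphere} = T -` ?C"
    proof (intro set_eqI)
      fix x
      have "T x = 0 \<longleftrightarrow> x = 0"
        using norm_T[of x] by (metis norm_eq_zero)
      then show "x \<in> {x \<in> ball 0 1 - {0}. x /\<^sub>R norm x \<in> T -` E \<inter> unit_sphere} \<longleftrightarrow> x \<in> T -` ?C"
        by (auto simp: linear_cmul[OF lin] norm_T)
    qed
    moreover have "emeasure lborel (T -` ?C) = emeasure (distr lborel borel T) ?C"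
      using C by (simp add: emeasure_distr)
    ultimately have "emeasure surface_measure (T -` E \<inter> unit_sphere) = emeasure surface_measure E"
      by (simp only: emeasure_surface_measure[OF TE] emeasure_surface_measure[OF E]
          cone_eq[OF E_sub] cone_eq[of "T -` E \<inter> unit_sphere", OF Int_lower2]
          lborel_distr_orthogonal[OF T])
    then have "emeasure sigma_sphere (T -` E \<inter> unit_sphere) = emeasure sigma_sphere E"
      by (simp add: c)
    moreover have "T \<in> measurable sigma_sphere sphere_borel"
      using T_meas sets_sigma by (simp cong: measurable_cong_sets)
    ultimately show "emeasure (distr sigma_sphere sphere_borel T) E = emeasure sigma_sphere E"
      using E by (simp add: emeasure_distr space_sigma)
  qed (simp add: sets_sigma)
qed

text \<open>Orthogonal maps act transitively on the sphere and preserve inner products and \<sigma>,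
  so a map taking \<open>y\<close> to \<open>y'\<close> serves as change of variables.\<close>

lemma potential_sigma_sphere_const:
  fixes F :: "real \<Rightarrow> real" and y y' :: "real ^ 'n"
  assumes [measurable]: "F \<in> borel_measurable borel" and "norm y = 1" "norm y' = 1"
  shows "(LINT x|sigma_sphere. F (x \<bullet> y)) = (LINT x|sigma_sphere. F (x \<bullet> y'))"
proof -
  obtain T where T: "orthogonal_transformation T" and y': "T y = y'"
    using orthogonal_transformation_exists_1 assms by metis
  have sets_sigma: "sets (sigma_sphere :: (real ^ 'n) measure) = sets sphere_borel"
    using sigma_sphere_in_prob_measures[where 'n='n] by (auto simp: prob_measures_def)
  have "(LINT x|sigma_sphere. F (x \<bullet> y')) = (LINT x|distr sigma_sphere sphere_borel T. F (x \<bullet> y'))"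
    by (simp add: sigma_sphere_distr_orthogonal(2)[OF T])
  also have "\<dots> = (LINT x|sigma_sphere. F (T x \<bullet> T y))"
    unfolding y' using sigma_sphere_distr_orthogonal(1)[OF T] sets_sigma
    by (intro integral_distr measurable_restrict_space1) (auto cong: measurable_cong_sets)
  also have "\<dots> = (LINT x|sigma_sphere. F (x \<bullet> y))"
    using T by (simp add: orthogonal_transformation_def)
  finally show ?thesis ..
qed

subsection \<open>Positive definite kernels\<close>

lemma inner_in_interval: "norm x = 1 \<Longrightarrow> norm y = 1 \<Longrightarrow> x \<bullet> y \<in> {-1..1::real}"
  using Cauchy_Schwarz_ineq2[of x y] by (auto simp: abs_le_iff)

lemma prob_spaceI_prob_measures: "\<mu> \<in> prob_measures \<Longrightarrow> prob_space \<mu>"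
  by (simp add: prob_measures_def)

section \<open>Product integrals and discretisation of measures\<close>

lemma integrable_pair_bounded:
  fixes f :: "'a \<times> 'b \<Rightarrow> real"
  assumes "prob_space M" "prob_space N" "f \<in> borel_measurable (M \<Otimes>\<^sub>M N)" "\<And>p. \<bar>f p\<bar> \<le> B"
  shows "integrable (M \<Otimes>\<^sub>M N) f"
proof -
  interpret pair_prob_space M N
    using assms by (simp add: pair_prob_space_def pair_sigma_finite_def prob_space_imp_sigma_finite)
  show ?thesis
    using assms by (intro integrable_const_bound[of _ B]) auto
qed

lemma integral_pair_bounded:
  fixes f :: "'a \<Rightarrow> 'b \<Rightarrow> real"
  assumes "prob_space M" "prob_space N" "case_prod f \<in> borel_measurable (M \<Otimes>\<^sub>M N)" "\<And>x y. \<bar>f x y\<bar> \<le> B"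
  shows "(LINT p|(M \<Otimes>\<^sub>M N). f (fst p) (snd p)) = (LINT y|N. LINT x|M. f x y)"
    and "(LINT p|(M \<Otimes>\<^sub>M N). f (fst p) (snd p)) = (LINT x|M. LINT y|N. f x y)"
proof -
  interpret pair_prob_space M N
    using assms by (simp add: pair_prob_space_def pair_sigma_finite_def prob_space_imp_sigma_finite)
  have "integrable (M \<Otimes>\<^sub>M N) (case_prod f)"
    using assms by (intro integrable_pair_bounded[of _ _ _ B]) auto
  from integral_fst[OF this] integral_snd[OF this]
  show "(LINT p|(M \<Otimes>\<^sub>M N). f (fst p) (snd p)) = (LINT y|N. LINT x|M. f x y)"
    "(LINT p|(M \<Otimes>\<^sub>M N). f (fst p) (snd p)) = (LINT x|M. LINT y|N. f x y)"
    by (simp_all add: case_prod_beta')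
qed

text \<open>The composition takes finitely many values, so its integral is a sum over the fibres of
  \<open>r\<close>.\<close>

lemma integral_simple_compose:
  fixes h :: "'b \<Rightarrow> real"
  assumes "finite_measure M" and r: "simple_function M r"
  shows "(LINT x|M. h (r x)) = (\<Sum>z\<in>r ` space M. h z * measure M (r -` {z} \<inter> space M))"
proof -
  interpret finite_measure M by fact
  have "(LINT x|M. h (r x)) = (LINT x|M. (\<Sum>z\<in>r ` space M. h z * indicator (r -` {z} \<inter> space M) x))"
  proof (intro Bochner_Integration.integral_cong refl)
    fix x assume x: "x \<in> space M"
    have "(\<Sum>z\<in>r ` space M. h z * indicator (r -` {z} \<inter> space M) x)
      = (\<Sum>z\<in>r ` space M. if z = r x then h z else 0)"
      using x by (intro sum.cong) (auto simp: indicator_def)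
    also have "\<dots> = h (r x)"
      using r x by (simp add: simple_function_def)
    finally show "h (r x) = (\<Sum>z\<in>r ` space M. h z * indicator (r -` {z} \<inter> space M) x)" ..
  qed
  also have "\<dots> = (\<Sum>z\<in>r ` space M. h z * measure M (r -` {z} \<inter> space M))"
    using simple_functionD(2)[OF r]
    by (subst Bochner_Integration.integral_sum)
      (auto simp: emeasure_finite less_top[symmetric] intro!: integrable_mult_right)
  finally show ?thesis .
qed

text \<open>Library approximations of the identity by simple functions take values in the ambient
  space. Normalizing them puts the values on the sphere, where positive definiteness can be applied,
  and keeps the limit because \<open>sgn\<close> is continuous off 0.\<close>

lemma simple_sphere_approximation:
  obtains r :: "nat \<Rightarrow> real ^ 'n \<Rightarrow> real ^ 'n"
  where "\<And>n. simple_function sphere_borel (r n)" "\<And>n x. norm (r n x) = 1"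
    and "\<And>x. norm x = 1 \<Longrightarrow> (\<lambda>n. r n x) \<longlonglongrightarrow> x"
proof -
  obtain e :: "real ^ 'n" where e: "norm e = 1"
    by (rule vector_choose_size[of 1]) auto
  obtain s :: "nat \<Rightarrow> real ^ 'n \<Rightarrow> real ^ 'n" where s: "\<And>n. simple_function sphere_borel (s n)"
    and lim: "\<And>x. norm x = 1 \<Longrightarrow> (\<lambda>n. s n x) \<longlonglongrightarrow> x"
  proof -
    have "(\<lambda>x. x) \<in> borel_measurable (sphere_borel :: (real ^ 'n) measure)"
      by (simp add: measurable_restrict_space1)
    from borel_measurable_implies_sequence_metric[OF this, of 0]
    obtain s :: "nat \<Rightarrow> real ^ 'n \<Rightarrow> real ^ 'n" where "\<And>n. simple_function sphere_borel (s n)"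
      and "\<And>x. x \<in> space sphere_borel \<Longrightarrow> (\<lambda>n. s n x) \<longlonglongrightarrow> x"
      by blast
    then show ?thesis
      by (intro that[of s]) (auto simp: space_restrict_space)
  qed
  \<comment> \<open>The value at 0 is an arbitrary unit vector; near a limit of norm 1 the
    approximations are eventually nonzero, so it does not affect convergence.\<close>
  define u where "u = (\<lambda>x. if x = 0 then e else sgn x)"
  have "(\<lambda>n. u (s n x)) \<longlonglongrightarrow> x" if x: "norm x = 1" for x
  proof -
    have "(\<lambda>n. sgn (s n x)) \<longlonglongrightarrow> sgn x"
      using x by (intro tendsto_sgn lim) auto
    moreover have "sgn x = x"
      using x by (simp add: sgn_div_norm)
    moreover have "\<forall>\<^sub>F n in sequentially. s n x \<noteq> 0"
      using x by (intro tendsto_imp_eventually_ne[OF lim]) auto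
    then have "\<forall>\<^sub>F n in sequentially. sgn (s n x) = u (s n x)"
      by eventually_elim (simp add: u_def)
    ultimately show ?thesis
      by (simp add: tendsto_cong)
  qed
  moreover have "simple_function sphere_borel (\<lambda>x. u (s n x))" for n
    using simple_function_compose[OF s, of u n] by (simp add: comp_def)
  moreover have "norm (u y) = 1" for y
    by (simp add: u_def e norm_sgn)
  ultimately show ?thesis
    by (intro that[of "\<lambda>n x. u (s n x)"])
qed

text \<open>The \<sigma>-algebra of \<mu> and \<nu> is that of the sphere rather than
  \<open>borel\<close>, so the projections are first turned into Borel functions into the ambient
  space.\<close>

lemma kernel_measurable:
  assumes "\<mu> \<in> prob_measures" "\<nu> \<in> prob_measures" and [measurable]: "F \<in> borel_measurable borel"
  shows "(\<lambda>p. F (fst p \<bullet> snd p)) \<in> borel_measurable (\<mu> \<Otimes>\<^sub>M \<nu>)"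
proof -
  have [measurable]: "(\<lambda>x. x) \<in> borel_measurable \<mu>" "(\<lambda>x. x) \<in> borel_measurable \<nu>"
    using assms by (auto intro: borel_measurable_prob_measures)
  have [measurable]: "fst \<in> borel_measurable (\<mu> \<Otimes>\<^sub>M \<nu>)" "snd \<in> borel_measurable (\<mu> \<Otimes>\<^sub>M \<nu>)"
    using measurable_compose[OF measurable_fst, of "\<lambda>x. x" \<mu> borel \<nu>]
      measurable_compose[OF measurable_snd, of "\<lambda>x. x" \<nu> borel \<mu>] by auto
  show ?thesis by measurable
qed

text \<open>The sums are the mutual energies of the finitely supported images of \<mu> and \<nu>
  under \<open>r n\<close>. Continuity of \<open>F\<close> gives pointwise convergence of the
  kernels, and the constant \<open>B\<close> dominates them.\<close>

lemma mutual_energy_approximation: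
  fixes r :: "nat \<Rightarrow> real ^ 'n \<Rightarrow> real ^ 'n"
  assumes \<mu>: "\<mu> \<in> prob_measures" and \<nu>: "\<nu> \<in> prob_measures"
    and cont: "continuous_on UNIV F" and bound: "\<And>t. \<bar>F t\<bar> \<le> B"
    and r: "\<And>n. simple_function sphere_borel (r n)" "\<And>n x. norm (r n x) = 1"
    and lim: "\<And>x. norm x = 1 \<Longrightarrow> (\<lambda>n. r n x) \<longlonglongrightarrow> x"
  shows "(\<lambda>n. \<Sum>w\<in>r n ` unit_sphere. \<Sum>z\<in>r n ` unit_sphere.
      F (z \<bullet> w) * measure \<mu> (r n -` {z} \<inter> unit_sphere) * measure \<nu> (r n -` {w} \<inter> unit_sphere))
    \<longlonglongrightarrow> (LINT y|\<nu>. LINT x|\<mu>. F (x \<bullet> y))"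
proof -
  interpret \<mu>: prob_space \<mu> using \<mu> by (rule prob_spaceI_prob_measures)
  interpret \<nu>: prob_space \<nu> using \<nu> by (rule prob_spaceI_prob_measures)
  interpret pair_prob_space \<mu> \<nu> ..
  have F[measurable]: "F \<in> borel_measurable borel"
    using cont by (rule borel_measurable_continuous_onI)
  have space: "space \<mu> = unit_sphere" "space \<nu> = unit_sphere"
    using \<mu> \<nu> by (auto dest: space_prob_measures)
  have simple: "simple_function \<mu> (r n)" "simple_function \<nu> (r n)" for n
    using r(1)[of n] \<mu> \<nu> by (auto simp: simple_function_def prob_measures_def space space_restrict_space)
  have meas: "(\<lambda>p. F (r n (fst p) \<bullet> r n (snd p))) \<in> borel_measurable (\<mu> \<Otimes>\<^sub>M \<nu>)" for n
  proof -
    have [measurable]: "r n \<in> borel_measurable \<mu>" "r n \<in> borel_measurable \<nu>"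
      using simple by (auto intro: borel_measurable_simple_function)
    show ?thesis by measurable
  qed
  have "(\<lambda>n. LINT p|(\<mu> \<Otimes>\<^sub>M \<nu>). F (r n (fst p) \<bullet> r n (snd p))) \<longlonglongrightarrow> (LINT p|(\<mu> \<Otimes>\<^sub>M \<nu>). F (fst p \<bullet> snd p))"
  proof (rule integral_dominated_convergence[where w="\<lambda>_. B"])
    show "(\<lambda>p. F (fst p \<bullet> snd p)) \<in> borel_measurable (\<mu> \<Otimes>\<^sub>M \<nu>)"
      using \<mu> \<nu> F by (rule kernel_measurable)
    show "AE p in \<mu> \<Otimes>\<^sub>M \<nu>. (\<lambda>n. F (r n (fst p) \<bullet> r n (snd p))) \<longlonglongrightarrow> F (fst p \<bullet> snd p)"
    proof (rule AE_I2)
      fix p assume "p \<in> space (\<mu> \<Otimes>\<^sub>M \<nu>)"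
      then have "norm (fst p) = 1" "norm (snd p) = 1"
        by (auto simp: space_pair_measure space)
      moreover have "isCont F (fst p \<bullet> snd p)"
        using cont by (simp add: continuous_on_eq_continuous_at)
      ultimately show "(\<lambda>n. F (r n (fst p) \<bullet> r n (snd p))) \<longlonglongrightarrow> F (fst p \<bullet> snd p)"
        by (intro isCont_tendsto_compose[of _ F] tendsto_inner lim)
    qed
  qed (use meas bound in auto)
  moreover have "(LINT p|(\<mu> \<Otimes>\<^sub>M \<nu>). F (fst p \<bullet> snd p)) = (LINT y|\<nu>. LINT x|\<mu>. F (x \<bullet> y))"
    using kernel_measurable[OF \<mu> \<nu> F] bound
    by (intro integral_pair_bounded \<mu>.prob_space_axioms \<nu>.prob_space_axioms) (auto simp: case_prod_beta')
  moreover have "(LINT p|(\<mu> \<Otimes>\<^sub>M \<nu>). F (r n (fst p) \<bullet> r n (snd p))) =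
    (\<Sum>w\<in>r n ` unit_sphere. \<Sum>z\<in>r n ` unit_sphere.
      F (z \<bullet> w) * measure \<mu> (r n -` {z} \<inter> unit_sphere) * measure \<nu> (r n -` {w} \<inter> unit_sphere))" for n
  proof -
    have "(LINT p|(\<mu> \<Otimes>\<^sub>M \<nu>). F (r n (fst p) \<bullet> r n (snd p))) = (LINT y|\<nu>. LINT x|\<mu>. F (r n x \<bullet> r n y))"
      using meas[of n] bound
      by (intro integral_pair_bounded \<mu>.prob_space_axioms \<nu>.prob_space_axioms) (auto simp: case_prod_beta')
    also have "\<dots> = (LINT y|\<nu>. (\<Sum>z\<in>r n ` unit_sphere. F (z \<bullet> r n y) * measure \<mu> (r n -` {z} \<inter> unit_sphere)))"
      by (subst integral_simple_compose[OF \<mu>.finite_measure_axioms simple(1)]) (simp add: space)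
    also have "\<dots> = (\<Sum>w\<in>r n ` unit_sphere. (\<Sum>z\<in>r n ` unit_sphere.
        F (z \<bullet> w) * measure \<mu> (r n -` {z} \<inter> unit_sphere)) * measure \<nu> (r n -` {w} \<inter> unit_sphere))"
      using integral_simple_compose[OF \<nu>.finite_measure_axioms simple(2),
        of "\<lambda>w. \<Sum>z\<in>r n ` unit_sphere. F (z \<bullet> w) * measure \<mu> (r n -` {z} \<inter> unit_sphere)"]
      by (simp add: space)
    finally show ?thesis
      by (simp add: sum_distrib_right)
  qed
  ultimately show ?thesis by simp
qed

lemma energy_sigma_sphere_minimal:
  fixes \<mu> :: "(real ^ 'n) measure"
  assumes \<mu>: "\<mu> \<in> prob_measures"
    and cont: "continuous_on UNIV F" and bound: "\<And>t. \<bar>F t\<bar> \<le> B"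
    and pd: "\<And>Z c. finite Z \<Longrightarrow> Z \<subseteq> (unit_sphere :: (real ^ 'n) set) \<Longrightarrow>
      (\<Sum>x\<in>Z. \<Sum>y\<in>Z. F (x \<bullet> y) * c x * c y) \<ge> 0"
  shows "energy F (sigma_sphere :: (real ^ 'n) measure) \<le> energy F \<mu>"
proof -
  let ?\<sigma> = "sigma_sphere :: (real ^ 'n) measure"
  interpret \<mu>: prob_space \<mu> using \<mu> by (rule prob_spaceI_prob_measures)
  interpret \<sigma>: prob_space ?\<sigma> using sigma_sphere_in_prob_measures by (rule prob_spaceI_prob_measures)
  have F: "F \<in> borel_measurable borel"
    using cont by (rule borel_measurable_continuous_onI)
  obtain r :: "nat \<Rightarrow> real ^ 'n \<Rightarrow> real ^ 'n" where r: "\<And>n. simple_function sphere_borel (r n)" "\<And>n x. norm (r n x) = 1"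
    and lim: "\<And>x. norm x = 1 \<Longrightarrow> (\<lambda>n. r n x) \<longlonglongrightarrow> x"
    by (rule simple_sphere_approximation) blast
  \<comment> \<open>\<open>m \<nu> n z\<close> is the mass at \<open>z\<close> of the image of \<nu>
    under \<open>r n\<close>, and \<open>M \<nu> \<rho> n\<close> is the mutual energy of two such
    images.\<close>
  define m where "m \<nu> n z = measure \<nu> (r n -` {z} \<inter> unit_sphere)" for \<nu> n z
  define M where "M \<nu> \<rho> n = (\<Sum>w\<in>r n ` unit_sphere. \<Sum>z\<in>r n ` unit_sphere. F (z \<bullet> w) * m \<nu> n z * m \<rho> n w)"
    for \<nu> \<rho> n
  have M_lim: "M \<nu> \<rho> \<longlonglongrightarrow> (LINT y|\<rho>. LINT x|\<nu>. F (x \<bullet> y))"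
    if "\<nu> \<in> prob_measures" "\<rho> \<in> prob_measures" for \<nu> \<rho>
    unfolding M_def m_def by (rule mutual_energy_approximation[OF that cont bound r lim])
  have M_sym: "M \<nu> \<rho> = M \<rho> \<nu>" for \<nu> \<rho>
    unfolding M_def by (subst sum.swap) (simp add: inner_commute mult_ac)
  have "0 \<le> M \<mu> \<mu> n - 2 * M ?\<sigma> \<mu> n + M ?\<sigma> ?\<sigma> n" for n
  proof -
    have "r n ` unit_sphere \<subseteq> unit_sphere" "finite (r n ` unit_sphere)"
      using r(1)[of n] r(2) by (auto simp: simple_function_def space_restrict_space)
    \<comment> \<open>These coefficients are the masses of the discretised signed measure \<mu> -
      \<sigma>; expanding the square gives two cross terms, equal by symmetry of the kernel.\<close>
    from pd[OF this(2,1), of "\<lambda>z. m \<mu> n z - m ?\<sigma> n z"]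
    have "0 \<le> M \<mu> \<mu> n - M \<mu> ?\<sigma> n - M ?\<sigma> \<mu> n + M ?\<sigma> ?\<sigma> n"
      by (subst (asm) sum.swap) (simp add: M_def algebra_simps sum.distrib sum_subtractf)
    then show ?thesis using M_sym[of \<mu> ?\<sigma>] by simp
  qed
  moreover have "(\<lambda>n. M \<mu> \<mu> n - 2 * M ?\<sigma> \<mu> n + M ?\<sigma> ?\<sigma> n) \<longlonglongrightarrow>
      energy F \<mu> - 2 * (LINT y|\<mu>. LINT x|?\<sigma>. F (x \<bullet> y)) + energy F ?\<sigma>"
    unfolding energy_def by (intro tendsto_intros M_lim \<mu> sigma_sphere_in_prob_measures)
  ultimately have "0 \<le> energy F \<mu> - 2 * (LINT y|\<mu>. LINT x|?\<sigma>. F (x \<bullet> y)) + energy F ?\<sigma>"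
    by (intro LIMSEQ_le_const) auto
  \<comment> \<open>The inner integral is the potential of \<sigma>, which is constant on the
    sphere; averaging it against any probability measure returns the constant. Using this for \<mu>
    and for \<sigma> evaluates the cross term.\<close>
  moreover have "(LINT y|\<mu>. LINT x|?\<sigma>. F (x \<bullet> y)) = energy F ?\<sigma>"
  proof -
    obtain e :: "real ^ 'n" where e: "norm e = 1"
      by (rule vector_choose_size[of 1]) auto
    have "(LINT y|\<nu>. LINT x|?\<sigma>. F (x \<bullet> y)) = (LINT x|?\<sigma>. F (x \<bullet> e))" if "\<nu> \<in> prob_measures" for \<nu>
    proof -
      interpret prob_space \<nu> using that by (rule prob_spaceI_prob_measures)
      have "(LINT y|\<nu>. LINT x|?\<sigma>. F (x \<bullet> y)) = (LINT y|\<nu>. LINT x|?\<sigma>. F (x \<bullet> e))"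
        using e by (intro Bochner_Integration.integral_cong refl potential_sigma_sphere_const F)
          (auto simp: space_prob_measures[OF that])
      then show ?thesis by (simp add: prob_space)
    qed
    from this[OF \<mu>] this[OF sigma_sphere_in_prob_measures] show ?thesis
      unfolding energy_def by (rule trans[OF _ sym])
  qed
  ultimately show ?thesis by simp
qed

subsection \<open>Perturbation by densities\<close>

text \<open>This is the mutual energy of the signed measures \<open>u \<sigma>\<close> and
  \<open>v \<sigma>\<close>. They are not of type \<open>measure\<close>, so the densities enter as
  factors of the integrand; a single product integral makes bilinear expansion plain
  linearity.\<close>

definition density_form :: "(real \<Rightarrow> real) \<Rightarrow> (real ^ 'n \<Rightarrow> real) \<Rightarrow> (real ^ 'n \<Rightarrow> real) \<Rightarrow> real"
  where "density_form F u v =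
    (LINT p|(sigma_sphere \<Otimes>\<^sub>M sigma_sphere). F (fst p \<bullet> snd p) * (u (fst p) * v (snd p)))"

lemma density_form_measurable:
  fixes u v :: "real ^ 'n \<Rightarrow> real"
  assumes F: "F \<in> borel_measurable borel"
    and u: "u \<in> borel_measurable borel" and v: "v \<in> borel_measurable borel"
  shows "(\<lambda>p. F (fst p \<bullet> snd p) * (u (fst p) * v (snd p)))
    \<in> borel_measurable (sigma_sphere \<Otimes>\<^sub>M sigma_sphere)"
proof -
  note [measurable] = kernel_measurable[OF sigma_sphere_in_prob_measures sigma_sphere_in_prob_measures F]
    borel_measurable_prob_measures[OF sigma_sphere_in_prob_measures u]
    borel_measurable_prob_measures[OF sigma_sphere_in_prob_measures v]
  show ?thesis by measurable
qed

lemma density_form_integrable: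
  fixes u v :: "real ^ 'n \<Rightarrow> real"
  assumes "F \<in> borel_measurable borel" "\<And>t. \<bar>F t\<bar> \<le> B"
    and "u \<in> borel_measurable borel" "\<And>x. \<bar>u x\<bar> \<le> b" and "v \<in> borel_measurable borel" "\<And>x. \<bar>v x\<bar> \<le> b'"
  shows "integrable (sigma_sphere \<Otimes>\<^sub>M sigma_sphere) (\<lambda>p. F (fst p \<bullet> snd p) * (u (fst p) * v (snd p)))"
proof (rule integrable_pair_bounded)
  show "\<bar>F (fst p \<bullet> snd p) * (u (fst p) * v (snd p))\<bar> \<le> B * (b * b')" for p
    unfolding abs_mult using assms(2,4,6) order_trans[OF abs_ge_zero assms(2)] order_trans[OF abs_ge_zero assms(4)]
    by (intro mult_mono) auto
qed (use assms in \<open>auto intro: density_form_measurable prob_spaceI_prob_measures[OF sigma_sphere_in_prob_measures]\<close>)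

text \<open>Both orders are provided because the constant potential of \<sigma> has to be pulled out
  on either side of the form.\<close>

lemma density_form_iterated:
  fixes u v :: "real ^ 'n \<Rightarrow> real"
  assumes "F \<in> borel_measurable borel" "\<And>t. \<bar>F t\<bar> \<le> B"
    and "u \<in> borel_measurable borel" "\<And>x. \<bar>u x\<bar> \<le> b" and "v \<in> borel_measurable borel" "\<And>x. \<bar>v x\<bar> \<le> b'"
  shows "density_form F u v = (LINT y|sigma_sphere. LINT x|sigma_sphere. F (x \<bullet> y) * (u x * v y))"
    and "density_form F u v = (LINT x|sigma_sphere. LINT y|sigma_sphere. F (x \<bullet> y) * (u x * v y))"
proof -
  have "\<bar>F (x \<bullet> y) * (u x * v y)\<bar> \<le> B * (b * b')" for x y
    unfolding abs_mult using assms(2,4,6) order_trans[OF abs_ge_zero assms(2)] order_trans[OF abs_ge_zero assms(4)]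
    by (intro mult_mono) auto
  moreover have "(\<lambda>(x, y). F (x \<bullet> y) * (u x * v y)) \<in> borel_measurable (sigma_sphere \<Otimes>\<^sub>M sigma_sphere)"
    using density_form_measurable assms by (simp add: case_prod_beta')
  moreover have "prob_space (sigma_sphere :: (real ^ 'n) measure)"
    by (rule prob_spaceI_prob_measures[OF sigma_sphere_in_prob_measures])
  ultimately show "density_form F u v = (LINT y|sigma_sphere. LINT x|sigma_sphere. F (x \<bullet> y) * (u x * v y))"
    "density_form F u v = (LINT x|sigma_sphere. LINT y|sigma_sphere. F (x \<bullet> y) * (u x * v y))"
    unfolding density_form_def
    using integral_pair_bounded[of sigma_sphere sigma_sphere "\<lambda>x y. F (x \<bullet> y) * (u x * v y)" "B * (b * b')"]
    by auto
qed

text \<open>Split \<open>g\<close> into its mean \<open>c\<close> and a mean-zero part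
  \<open>h\<close>. The cross terms vanish, the constant part contributes \<open>c\<^sup>2\<close>
  times the energy of \<sigma>, and minimality against a small perturbation along \<open>h\<close>
  handles the rest.\<close>

lemma density_form_nonneg:
  fixes g :: "real ^ 'n \<Rightarrow> real"
  assumes F[measurable]: "F \<in> borel_measurable borel" and bound: "\<And>t. \<bar>F t\<bar> \<le> B"
    and minimal: "\<And>\<mu> :: (real ^ 'n) measure. \<mu> \<in> prob_measures \<Longrightarrow>
      energy F (sigma_sphere :: (real ^ 'n) measure) \<le> energy F \<mu>"
    and nonneg: "energy F (sigma_sphere :: (real ^ 'n) measure) \<ge> 0"
    and g: "g \<in> borel_measurable borel" and g_bound: "\<And>x. \<bar>g x\<bar> \<le> b"
  shows "density_form F g g \<ge> 0"
proof -
  let ?\<sigma> = "sigma_sphere :: (real ^ 'n) measure"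
  let ?one = "\<lambda>_ :: real ^ 'n. 1 :: real"
  interpret prob_space ?\<sigma>
    by (rule prob_spaceI_prob_measures[OF sigma_sphere_in_prob_measures])
  note [measurable] = g borel_measurable_prob_measures[OF sigma_sphere_in_prob_measures g]
  define c where "c = (LINT x|?\<sigma>. g x)"
  define h where "h x = g x - c" for x
  define H where "H = b + \<bar>c\<bar>"
  have h[measurable]: "h \<in> borel_measurable borel"
    unfolding h_def by measurable
  have h_\<sigma>[measurable]: "h \<in> borel_measurable ?\<sigma>"
    using h by (rule borel_measurable_prob_measures[OF sigma_sphere_in_prob_measures])
  have h_bound: "\<bar>h x\<bar> \<le> H" for x
    using g_bound[of x] by (simp add: h_def H_def)
  have "integrable ?\<sigma> g"
    using g_bound by (intro integrable_const_bound[of _ b]) auto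
  then have h_int: "integrable ?\<sigma> h" and h_mean: "(LINT x|?\<sigma>. h x) = 0"
    by (simp_all add: h_def[abs_def] c_def prob_space)
  obtain e :: "real ^ 'n" where e: "norm e = 1"
    by (rule vector_choose_size[of 1]) auto
  define U where "U = (LINT x|?\<sigma>. F (x \<bullet> e))"
  have U: "(LINT x|?\<sigma>. F (x \<bullet> y)) = U" if "y \<in> space ?\<sigma>" for y
    using that e unfolding U_def
    by (intro potential_sigma_sphere_const F) (auto simp: space_prob_measures[OF sigma_sphere_in_prob_measures])
  have U': "(LINT x|?\<sigma>. F (y \<bullet> x)) = U" if "y \<in> space ?\<sigma>" for y
    using U[OF that] by (simp add: inner_commute[of y])
  have one: "?one \<in> borel_measurable borel" "\<And>x :: real ^ 'n. \<bar>1 :: real\<bar> \<le> 1"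
    by auto
  \<comment> \<open>Integrating first over the variable carrying the constant density leaves
    \<open>U\<close> times the mean of \<open>h\<close>.\<close>
  have "density_form F ?one h = (LINT y|?\<sigma>. LINT x|?\<sigma>. F (x \<bullet> y) * (1 * h y))"
    by (rule density_form_iterated(1)[OF F bound one h h_bound])
  also have "\<dots> = (LINT y|?\<sigma>. U * h y)"
    by (intro Bochner_Integration.integral_cong refl) (simp add: U)
  finally have one_h: "density_form F ?one h = 0"
    by (simp add: h_mean)
  have "density_form F h ?one = (LINT x|?\<sigma>. LINT y|?\<sigma>. F (x \<bullet> y) * (h x * 1))"
    by (rule density_form_iterated(2)[OF F bound h h_bound one])
  also have "\<dots> = (LINT x|?\<sigma>. U * h x)"
    by (intro Bochner_Integration.integral_cong refl) (simp add: U')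
  finally have h_one: "density_form F h ?one = 0"
    by (simp add: h_mean)
  have energy_form: "energy F ?\<sigma> = density_form F ?one ?one"
    using density_form_iterated(1)[OF F bound one one] by (simp add: energy_def)
  \<comment> \<open>Used twice: with \<open>a = 1\<close> and small \<epsilon> for the competitor of
    \<sigma>, and with \<open>a = c\<close>, \<epsilon> = 1 for \<open>g\<close> itself.\<close>
  have expand: "density_form F (\<lambda>x. a + \<epsilon> * h x) (\<lambda>x. a + \<epsilon> * h x)
      = a\<^sup>2 * energy F ?\<sigma> + \<epsilon>\<^sup>2 * density_form F h h" for a \<epsilon>
  proof -
    let ?K = "\<lambda>u v p. F (fst p \<bullet> snd p) * (u (fst p :: real ^ 'n) * v (snd p :: real ^ 'n)) :: real"
    note ints = density_form_integrable[OF F bound one one] density_form_integrable[OF F bound one h h_bound]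
      density_form_integrable[OF F bound h h_bound one] density_form_integrable[OF F bound h h_bound h h_bound]
    have "density_form F (\<lambda>x. a + \<epsilon> * h x) (\<lambda>x. a + \<epsilon> * h x)
      = (LINT p|(?\<sigma> \<Otimes>\<^sub>M ?\<sigma>). a\<^sup>2 * ?K ?one ?one p + a * \<epsilon> * ?K ?one h p
          + a * \<epsilon> * ?K h ?one p + \<epsilon>\<^sup>2 * ?K h h p)"
      unfolding density_form_def
      by (intro Bochner_Integration.integral_cong refl) (simp add: algebra_simps power2_eq_square)
    also have "\<dots> = a\<^sup>2 * density_form F ?one ?one + a * \<epsilon> * density_form F ?one h
        + a * \<epsilon> * density_form F h ?one + \<epsilon>\<^sup>2 * density_form F h h"
      unfolding density_form_def using ints
      by (simp only: Bochner_Integration.integral_add Bochner_Integration.integrable_add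
          integrable_mult_right integral_mult_right_zero)
    finally show ?thesis
      by (simp add: one_h h_one energy_form)
  qed
  have "density_form F h h \<ge> 0"
  proof -
    \<comment> \<open>This size makes \<open>1 + \<epsilon> * h x\<close> nonnegative, hence a
      density; adding 1 to \<open>H\<close> keeps the denominator positive when
      \<open>H = 0\<close>.\<close>
    define \<epsilon> where "\<epsilon> = 1 / (H + 1)"
    have "H \<ge> 0"
      using order_trans[OF abs_ge_zero h_bound] .
    then have \<epsilon>: "\<epsilon> > 0" "\<epsilon> * H \<le> 1"
      by (simp_all add: \<epsilon>_def)
    have pos: "0 \<le> 1 + \<epsilon> * h x" for x
    proof -
      have "\<epsilon> * \<bar>h x\<bar> \<le> \<epsilon> * H"
        using \<epsilon>(1) h_bound by (intro mult_left_mono) auto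
      moreover have "\<bar>\<epsilon> * h x\<bar> = \<epsilon> * \<bar>h x\<bar>"
        using \<epsilon>(1) by (simp add: abs_mult)
      ultimately show ?thesis
        using \<epsilon>(2) by linarith
    qed
    \<comment> \<open>The total mass stays 1 because \<open>h\<close> has mean zero, so \<tau> is an
      admissible competitor.\<close>
    define \<tau> where "\<tau> = density ?\<sigma> (\<lambda>x. ennreal (1 + \<epsilon> * h x))"
    have "emeasure \<tau> (space \<tau>) = (\<integral>\<^sup>+x. ennreal (1 + \<epsilon> * h x) \<partial>?\<sigma>)"
      by (simp add: \<tau>_def emeasure_density cong: nn_integral_cong)
    also have "\<dots> = ennreal (LINT x|?\<sigma>. 1 + \<epsilon> * h x)"
      using h_int pos by (intro nn_integral_eq_integral) auto
    also have "\<dots> = 1"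
      using h_int by (simp add: h_mean prob_space)
    finally have \<tau>: "\<tau> \<in> prob_measures"
      using sigma_sphere_in_prob_measures[where 'n='n]
      by (auto simp: prob_measures_def \<tau>_def intro!: prob_spaceI)
    have u: "(\<lambda>x. 1 + \<epsilon> * h x) \<in> borel_measurable borel" by measurable
    have u_bound: "\<bar>1 + \<epsilon> * h x\<bar> \<le> 1 + \<epsilon> * H" for x
      using pos[of x] mult_left_mono[of "h x" H \<epsilon>] h_bound[of x] \<epsilon>(1) by linarith
    have \<tau>_int: "(LINT x|\<tau>. f x) = (LINT x|?\<sigma>. (1 + \<epsilon> * h x) * f x)"
      if "f \<in> borel_measurable ?\<sigma>" for f :: "real ^ 'n \<Rightarrow> real"
      unfolding \<tau>_def using that pos by (intro integral_real_density) auto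
    have inner: "(LINT x|\<tau>. F (x \<bullet> y)) = (LINT x|?\<sigma>. (1 + \<epsilon> * h x) * F (x \<bullet> y))" for y
      by (intro \<tau>_int borel_measurable_prob_measures[OF sigma_sphere_in_prob_measures]) measurable
    \<comment> \<open>Rewriting the outer integral by \<open>\<tau>_int\<close> requires the
      potential of \<tau> to be measurable as a function of \<open>y\<close>.\<close>
    have "(\<lambda>y. LINT x|?\<sigma>. F (y \<bullet> x) * ((1 + \<epsilon> * h x) * 1)) \<in> borel_measurable ?\<sigma>"
    proof (rule borel_measurable_lebesgue_integral)
      show "(\<lambda>(y, x). F (y \<bullet> x) * ((1 + \<epsilon> * h x) * 1)) \<in> borel_measurable (?\<sigma> \<Otimes>\<^sub>M ?\<sigma>)"
        using density_form_measurable[OF F one(1) u] by (simp add: case_prod_beta')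
    qed
    then have meas: "(\<lambda>y. LINT x|?\<sigma>. (1 + \<epsilon> * h x) * F (x \<bullet> y)) \<in> borel_measurable ?\<sigma>"
      by (simp add: inner_commute mult.commute)
    have "energy F \<tau> = (LINT y|?\<sigma>. (1 + \<epsilon> * h y) * (LINT x|?\<sigma>. (1 + \<epsilon> * h x) * F (x \<bullet> y)))"
      unfolding energy_def inner by (rule \<tau>_int[OF meas])
    also have "\<dots> = (LINT y|?\<sigma>. LINT x|?\<sigma>. F (x \<bullet> y) * ((1 + \<epsilon> * h x) * (1 + \<epsilon> * h y)))"
      by (simp add: mult_ac flip: integral_mult_right_zero)
    also have "\<dots> = density_form F (\<lambda>x. 1 + \<epsilon> * h x) (\<lambda>x. 1 + \<epsilon> * h x)"
      by (rule density_form_iterated(1)[OF F bound u u_bound u u_bound, symmetric])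
    also have "\<dots> = energy F ?\<sigma> + \<epsilon>\<^sup>2 * density_form F h h"
      by (simp add: expand)
    finally have "0 \<le> \<epsilon>\<^sup>2 * density_form F h h"
      using minimal[OF \<tau>] by simp
    then show ?thesis
      using \<epsilon>(1) by (simp add: zero_le_mult_iff)
  qed
  moreover have "density_form F g g = c\<^sup>2 * energy F ?\<sigma> + density_form F h h"
    using expand[of c 1] by (simp add: h_def)
  ultimately show ?thesis
    using nonneg by simp
qed

text \<open>Normalized indicators of small caps act as approximate point masses. For their
  combination with coefficients \<open>c z\<close>, uniform continuity makes the density form differ
  from the quadratic form of \<open>F\<close> by at most a multiple of \<epsilon>, which then tends
  to 0.\<close>

lemma positive_definite_of_density_form:
  assumes cont: "continuous_on UNIV F" and bound: "\<And>t. \<bar>F t\<bar> \<le> B"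
    and nonneg: "\<And>(g :: real ^ 'n \<Rightarrow> real) b. g \<in> borel_measurable borel \<Longrightarrow> (\<And>x. \<bar>g x\<bar> \<le> b) \<Longrightarrow> density_form F g g \<ge> 0"
    and Z: "finite Z" "Z \<subseteq> (unit_sphere :: (real ^ 'n) set)"
  shows "(\<Sum>x\<in>Z. \<Sum>y\<in>Z. F (x \<bullet> y) * c x * c y) \<ge> 0"
proof -
  let ?\<sigma> = "sigma_sphere :: (real ^ 'n) measure"
  let ?S = "\<Sum>x\<in>Z. \<Sum>y\<in>Z. F (x \<bullet> y) * c x * c y"
  interpret prob_space ?\<sigma>
    by (rule prob_spaceI_prob_measures[OF sigma_sphere_in_prob_measures])
  have F: "F \<in> borel_measurable borel"
    using cont by (rule borel_measurable_continuous_onI)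
  define C where "C = (\<Sum>z\<in>Z. \<bar>c z\<bar>)"
  \<comment> \<open>Each pair \<open>z\<close>, \<open>w\<close> costs at most \<epsilon> times
    \<open>\<bar>c z\<bar> * \<bar>c w\<bar>\<close>, and these weights add up to
    \<open>C\<^sup>2\<close>.\<close>
  have "0 \<le> ?S + \<epsilon> * C\<^sup>2" if "\<epsilon> > 0" for \<epsilon>
  proof -
    have "uniformly_continuous_on {-1..1} F"
      using cont by (intro compact_uniformly_continuous) (auto intro: continuous_on_subset)
    then obtain \<delta> where \<delta>: "\<delta> > 0"
      and unif: "\<And>s t. s \<in> {-1..1} \<Longrightarrow> t \<in> {-1..1} \<Longrightarrow> dist s t < \<delta> \<Longrightarrow> dist (F s) (F t) < \<epsilon>"
      using \<open>\<epsilon> > 0\<close> unfolding uniformly_continuous_on_def by metis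
    \<comment> \<open>Each argument moves by less than \<open>\<delta> / 2\<close>, which changes
      the inner product of unit vectors by less than \<delta>.\<close>
    have near: "\<bar>F (x \<bullet> y) - F (z \<bullet> w)\<bar> \<le> \<epsilon>"
      if "norm x = 1" "norm y = 1" "norm z = 1" "norm w = 1" "dist z x < \<delta> / 2" "dist w y < \<delta> / 2"
      for x y z w :: "real ^ 'n"
    proof -
      have "x \<bullet> y - z \<bullet> w = (x - z) \<bullet> y + z \<bullet> (y - w)"
        by (simp add: inner_diff_left inner_diff_right)
      moreover have "\<bar>(x - z) \<bullet> y\<bar> \<le> norm (x - z)" "\<bar>z \<bullet> (y - w)\<bar> \<le> norm (y - w)"
        using Cauchy_Schwarz_ineq2[of "x - z" y] Cauchy_Schwarz_ineq2[of z "y - w"] that by auto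
      ultimately have "dist (x \<bullet> y) (z \<bullet> w) < \<delta>"
        using that(5,6) by (simp add: dist_real_def dist_norm norm_minus_commute)
      then show ?thesis
        using unif[of "x \<bullet> y" "z \<bullet> w"] that inner_in_interval[of x y] inner_in_interval[of z w] by (simp add: dist_real_def)
    qed
    define A where "A z = ball z (\<delta> / 2) \<inter> unit_sphere" for z :: "real ^ 'n"
    have A_pos: "measure ?\<sigma> (A z) > 0" if "z \<in> Z" for z
      using that Z(2) \<delta> unfolding A_def by (intro sigma_sphere_cap_pos) auto
    have A_sets: "A z \<in> sets ?\<sigma>" for z
      using sigma_sphere_in_prob_measures[where 'n='n]
      by (auto simp: prob_measures_def A_def sets_restrict_space_iff)
    define \<phi> where "\<phi> z x = indicator (A z) x / measure ?\<sigma> (A z)" for z x :: "real ^ 'n"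
    have \<phi>: "\<phi> z \<in> borel_measurable borel" for z
      unfolding \<phi>_def A_def by (intro borel_measurable_divide borel_measurable_indicator) auto
    have \<phi>_nonneg: "0 \<le> \<phi> z x" for z x
      by (simp add: \<phi>_def)
    have \<phi>_bound: "\<bar>\<phi> z x\<bar> \<le> 1 / measure ?\<sigma> (A z)" for z x
      by (auto simp: \<phi>_def indicator_def)
    have \<phi>_integral: "(LINT x|?\<sigma>. \<phi> z x) = 1" if "z \<in> Z" for z
      using A_pos[OF that] A_sets[of z] sets.sets_into_space[OF A_sets] by (simp add: \<phi>_def Int_absorb2)
    \<comment> \<open>With the constant kernel 1, the facts on \<open>density_form\<close> say that
      the product density is integrable with integral 1.\<close>
    have one_int: "integrable (?\<sigma> \<Otimes>\<^sub>M ?\<sigma>) (\<lambda>p. \<phi> z (fst p) * \<phi> w (snd p))"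
      and one_form: "z \<in> Z \<Longrightarrow> w \<in> Z \<Longrightarrow> (LINT p|(?\<sigma> \<Otimes>\<^sub>M ?\<sigma>). \<phi> z (fst p) * \<phi> w (snd p)) = 1" for z w
      using density_form_integrable[of "\<lambda>_. 1" 1, OF _ _ \<phi> \<phi>_bound \<phi> \<phi>_bound]
        density_form_iterated(1)[of "\<lambda>_. 1" 1, OF _ _ \<phi> \<phi>_bound \<phi> \<phi>_bound, of z w] \<phi>_integral
      by (simp_all add: density_form_def)
    note form_int = density_form_integrable[OF F bound \<phi> \<phi>_bound \<phi> \<phi>_bound]
    have close: "\<bar>density_form F (\<phi> z) (\<phi> w) - F (z \<bullet> w)\<bar> \<le> \<epsilon>" if "z \<in> Z" "w \<in> Z" for z w
    proof -
      let ?D = "\<lambda>p. F (fst p \<bullet> snd p) * (\<phi> z (fst p) * \<phi> w (snd p)) - F (z \<bullet> w) * (\<phi> z (fst p) * \<phi> w (snd p))"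
      have D_int: "integrable (?\<sigma> \<Otimes>\<^sub>M ?\<sigma>) ?D"
        using form_int one_int by simp
      have "density_form F (\<phi> z) (\<phi> w) - F (z \<bullet> w) = (LINT p|(?\<sigma> \<Otimes>\<^sub>M ?\<sigma>). ?D p)"
        using form_int one_int one_form[OF that] by (simp add: density_form_def)
      then have "\<bar>density_form F (\<phi> z) (\<phi> w) - F (z \<bullet> w)\<bar> = \<bar>LINT p|(?\<sigma> \<Otimes>\<^sub>M ?\<sigma>). ?D p\<bar>"
        by (rule arg_cong)
      also have "\<dots> \<le> (LINT p|(?\<sigma> \<Otimes>\<^sub>M ?\<sigma>). \<bar>?D p\<bar>)"
        by (rule integral_abs_bound)
      also have "\<dots> \<le> (LINT p|(?\<sigma> \<Otimes>\<^sub>M ?\<sigma>). \<epsilon> * (\<phi> z (fst p) * \<phi> w (snd p)))"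
      proof (rule integral_mono)
        \<comment> \<open>On the product of the two caps the kernel is \<epsilon>-close to
          \<open>F (z \<bullet> w)\<close>; elsewhere the product density vanishes and both sides
          are 0.\<close>
        show "\<bar>?D p\<bar> \<le> \<epsilon> * (\<phi> z (fst p) * \<phi> w (snd p))" for p
        proof (cases "fst p \<in> A z \<and> snd p \<in> A w")
          case True
          have "?D p = (F (fst p \<bullet> snd p) - F (z \<bullet> w)) * (\<phi> z (fst p) * \<phi> w (snd p))"
            by (simp add: algebra_simps)
          moreover have "\<bar>F (fst p \<bullet> snd p) - F (z \<bullet> w)\<bar> \<le> \<epsilon>"
            using True that Z(2) by (intro near) (auto simp: A_def)
          ultimately show ?thesis
            using \<phi>_nonneg by (simp add: abs_mult mult_right_mono)
        next
          case False
          then have "\<phi> z (fst p) * \<phi> w (snd p) = 0" by (auto simp: \<phi>_def)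
          then show ?thesis
            by (simp only: mult_zero_right diff_self abs_zero order_refl)
        qed
      qed (use D_int one_int in auto)
      also have "\<dots> = \<epsilon>"
        using one_form[OF that] by simp
      finally show ?thesis .
    qed
    define g where "g x = (\<Sum>z\<in>Z. c z * \<phi> z x)" for x
    have "0 \<le> density_form F g g"
    proof (rule nonneg)
      show "g \<in> borel_measurable borel"
        unfolding g_def using \<phi> by measurable
      show "\<bar>g x\<bar> \<le> (\<Sum>z\<in>Z. \<bar>c z\<bar> * (1 / measure ?\<sigma> (A z)))" for x
        unfolding g_def
        by (rule order_trans[OF sum_abs sum_mono]) (metis abs_mult abs_ge_zero mult_left_mono \<phi>_bound)
    qed
    also have "density_form F g g = (LINT p|(?\<sigma> \<Otimes>\<^sub>M ?\<sigma>). (\<Sum>z\<in>Z. \<Sum>w\<in>Z.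
        c z * c w * (F (fst p \<bullet> snd p) * (\<phi> z (fst p) * \<phi> w (snd p)))))"
      unfolding density_form_def g_def
      by (intro Bochner_Integration.integral_cong refl, subst sum_product)
        (simp add: sum_distrib_left mult_ac)
    also have "\<dots> = (\<Sum>z\<in>Z. \<Sum>w\<in>Z. c z * c w * density_form F (\<phi> z) (\<phi> w))"
      unfolding density_form_def using form_int
      by (simp add: Bochner_Integration.integral_sum)
    also have "\<dots> \<le> (\<Sum>z\<in>Z. \<Sum>w\<in>Z. F (z \<bullet> w) * c z * c w + \<epsilon> * (\<bar>c z\<bar> * \<bar>c w\<bar>))"
    proof (intro sum_mono)
      fix z w assume zw: "z \<in> Z" "w \<in> Z"
      have "c z * c w * (density_form F (\<phi> z) (\<phi> w) - F (z \<bullet> w))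
          \<le> \<bar>c z * c w\<bar> * \<bar>density_form F (\<phi> z) (\<phi> w) - F (z \<bullet> w)\<bar>"
        by (metis abs_ge_self abs_mult)
      also have "\<dots> \<le> \<bar>c z * c w\<bar> * \<epsilon>"
        using close[OF zw] by (intro mult_left_mono) auto
      finally show "c z * c w * density_form F (\<phi> z) (\<phi> w) \<le> F (z \<bullet> w) * c z * c w + \<epsilon> * (\<bar>c z\<bar> * \<bar>c w\<bar>)"
        by (simp add: algebra_simps abs_mult)
    qed
    also have "\<dots> = ?S + \<epsilon> * (\<Sum>z\<in>Z. \<Sum>w\<in>Z. \<bar>c z\<bar> * \<bar>c w\<bar>)"
      by (simp add: sum.distrib sum_distrib_left)
    also have "(\<Sum>z\<in>Z. \<Sum>w\<in>Z. \<bar>c z\<bar> * \<bar>c w\<bar>) = C\<^sup>2"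
      unfolding C_def power2_eq_square by (rule sum_product[symmetric])
    finally show ?thesis .
  qed
  note approx = this
  show ?thesis
  proof (rule field_le_epsilon)
    fix e :: real assume "e > 0"
    have "C\<^sup>2 + 1 > 0"
      by (simp add: add_nonneg_pos)
    \<comment> \<open>Dividing by \<open>C\<^sup>2 + 1\<close> brings the error below
      \<open>e\<close> and also covers \<open>C = 0\<close>.\<close>
    then have "0 \<le> ?S + e / (C\<^sup>2 + 1) * C\<^sup>2"
      using \<open>e > 0\<close> by (intro approx) auto
    also have "e / (C\<^sup>2 + 1) * C\<^sup>2 \<le> e"
      using \<open>e > 0\<close> \<open>C\<^sup>2 + 1 > 0\<close> by (simp add: field_simps)
    finally show "0 \<le> ?S + e" by simp
  qed
qed

section \<open>The equivalence, via a bounded continuous extension of \<open>F\<close>\<close>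

theorem theorem5p6:
  fixes d :: nat and F :: "real \<Rightarrow> real"
  assumes "d \<ge> 1"
    and "CARD('n::finite) = d + 1"
    and "continuous_on {-1..1} F"
    and "energy F (sigma_sphere :: (real ^ 'n) measure) \<ge> 0"
  shows "is_arg_min (energy F) (\<lambda>\<mu>. \<mu> \<in> prob_measures) (sigma_sphere :: (real ^ 'n) measure)
    \<longleftrightarrow> F \<in> Phi TYPE('n)"
proof -
  \<comment> \<open>\<open>ext_cont\<close> continues \<open>F\<close> by its endpoint values, so
    \<open>G\<close> is continuous, bounded and Borel on the whole line, as the lemmas require.
    Inner products of unit vectors lie in \<open>{-1..1}\<close>, so energies and quadratic forms
    are unchanged.\<close>
  define G where "G = ext_cont F (-1) 1"
  have G_eq: "G t = F t" if "t \<in> {-1..1}" for t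
    using that by (simp add: G_def)
  have cont: "continuous_on UNIV G"
    unfolding G_def using assms(3) by (intro continuous_on_ext_cont) simp
  have "bounded (range G)"
    unfolding G_def ext_cont_def using assms(3)
    by (intro clamp_bounded compact_imp_bounded compact_continuous_image) auto
  then obtain B where bound: "\<And>t. \<bar>G t\<bar> \<le> B"
    by (auto simp: bounded_iff)
  have energy_eq: "energy G \<mu> = energy F \<mu>" if "\<mu> \<in> prob_measures" for \<mu> :: "(real ^ 'n) measure"
    unfolding energy_def using space_prob_measures[OF that]
    by (intro Bochner_Integration.integral_cong refl G_eq inner_in_interval) auto
  have sum_eq: "(\<Sum>x\<in>Z. \<Sum>y\<in>Z. G (x \<bullet> y) * c x * c y) = (\<Sum>x\<in>Z. \<Sum>y\<in>Z. F (x \<bullet> y) * c x * c y)"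
    if "Z \<subseteq> (unit_sphere :: (real ^ 'n) set)" for Z c
    using that by (intro sum.cong refl arg_cong2[where f="(*)"] G_eq inner_in_interval) auto
  have G_meas: "G \<in> borel_measurable borel"
    using cont by (rule borel_measurable_continuous_onI)
  note \<sigma> = sigma_sphere_in_prob_measures[where 'n='n]
  show ?thesis
  proof
    assume "is_arg_min (energy F) (\<lambda>\<mu>. \<mu> \<in> prob_measures) (sigma_sphere :: (real ^ 'n) measure)"
    then have minimal: "energy G (sigma_sphere :: (real ^ 'n) measure) \<le> energy G \<mu>" if "\<mu> \<in> prob_measures" for \<mu> :: "(real ^ 'n) measure"
      using that \<sigma> by (auto simp: is_arg_min_def energy_eq not_less)
    have "energy G (sigma_sphere :: (real ^ 'n) measure) \<ge> 0"
      using assms(4) \<sigma> by (simp add: energy_eq)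
    then have form_nonneg: "density_form G g g \<ge> 0"
      if "g \<in> borel_measurable borel" "\<And>x. \<bar>g x\<bar> \<le> b" for g :: "real ^ 'n \<Rightarrow> real" and b
      using density_form_nonneg[where F=G and g=g] G_meas bound minimal that by blast
    show "F \<in> Phi TYPE('n)"
      unfolding Phi_def
    proof (intro CollectI conjI allI impI)
      fix Z :: "(real ^ 'n) set" and c assume "finite Z \<and> Z \<subseteq> unit_sphere"
      then have Z: "finite Z" "Z \<subseteq> unit_sphere" by auto
      have "(\<Sum>x\<in>Z. \<Sum>y\<in>Z. G (x \<bullet> y) * c x * c y) \<ge> 0"
        by (rule positive_definite_of_density_form[OF cont bound _ Z]) (rule form_nonneg)
      then show "(\<Sum>x\<in>Z. \<Sum>y\<in>Z. F (x \<bullet> y) * c x * c y) \<ge> 0"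
        using sum_eq[OF Z(2)] by simp
    qed (rule assms(3))
  next
    assume "F \<in> Phi TYPE('n)"
    then have "(\<Sum>x\<in>Z. \<Sum>y\<in>Z. G (x \<bullet> y) * c x * c y) \<ge> 0"
      if "finite Z" "Z \<subseteq> (unit_sphere :: (real ^ 'n) set)" for Z c
      using that sum_eq[of Z c] by (auto simp: Phi_def)
    from energy_sigma_sphere_minimal[OF _ cont bound this]
    show "is_arg_min (energy F) (\<lambda>\<mu>. \<mu> \<in> prob_measures) (sigma_sphere :: (real ^ 'n) measure)"
      using \<sigma> by (auto simp: is_arg_min_def energy_eq not_less)
  qed
qed

end
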